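(* Let $T$ be a $k$-triangulation of the $n$-gon. Any $k$-relevant angle of $T$ belongs to a unique $k$-star contained in $T$.
   Context: Let $k\ge1$, $n\ge2k+1$. $V_n$ is the vertex set of a convex $n$-gon on the unit circle labelled counterclockwise by $\mathbb{Z}_n$; $u\prec v\prec w$ denotes counterclockwise order. The length of edge $[u,v]$ is $\min(|\{w: u\preccurlyeq w\prec v\}|,|\{w: v\preccurlyeq w\prec u\}|)$. Edges cross if their open segments intersect; an $\ell$-crossing is a set of $\ell$ mutually crossing edges. A $k$-triangulation is a maximal $(k+1)$-crossing-free set of edges on $V_n$. Edges of length $>k$ are $k$-relevant, of length $=k$ are $k$-boundary edges. An angle $\angle(u,v,w)$ of an edge set $E$ is a pair $\{[u,v],[v,w]\}\subseteq E$ with $u\prec v\prec w$ such that no edge $[v,t]$ with $w\prec t\prec u$ is in $E$; it is $k$-relevant if both its edges are $k$-relevant or $k$-boundary edges. A $k$-star is a set of edges $\{[s_j,s_{j+k}]: j\in\mathbb{Z}_{2k+1}\}$ with $s_0\prec\dots\prec s_{2k}\prec s_0$; an angle belongs to a $k$-star if it is an angle of that star. *)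

theory Defs
  imports "HOL-Analysis.Analysis"
begin

text \<open>
  The labels in \<open>\<int>\<^sub>n\<close> are represented by the naturals below \<open>n\<close>. The vertex labelled \<open>i\<close> is placed
  at the point \<open>p i\<close> of the unit circle in the complex plane.
\<close>

definition inscribed_polygon :: "nat \<Rightarrow> (nat \<Rightarrow> complex) \<Rightarrow> bool" where
  "inscribed_polygon n p \<longleftrightarrow>
    (\<exists>\<theta> :: nat \<Rightarrow> real.
       (\<forall>i j. i < j \<longrightarrow> j < n \<longrightarrow> \<theta> i < \<theta> j \<and> \<theta> j < \<theta> i + 2 * pi) \<and>
       (\<forall>i<n. p i = cis (\<theta> i)))"

definition ccw :: "nat \<Rightarrow> nat \<Rightarrow> nat \<Rightarrow> bool" where
  "ccw u v w \<longleftrightarrow> (u < v \<and> v < w) \<or> (v < w \<and> w < u) \<or> (w < u \<and> u < v)"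

text \<open>The half-open cyclic interval from \<open>u\<close> to \<open>v\<close>, for \<open>u \<noteq> v\<close>.\<close>

definition cyclic_interval :: "nat \<Rightarrow> nat \<Rightarrow> nat \<Rightarrow> nat set" where
  "cyclic_interval n u v = {w. w < n \<and> (w = u \<or> ccw u w v)}"

definition edge_length :: "nat \<Rightarrow> nat \<Rightarrow> nat \<Rightarrow> nat" where
  "edge_length n u v = min (card (cyclic_interval n u v)) (card (cyclic_interval n v u))"

definition all_edges :: "nat \<Rightarrow> nat set set" where
  "all_edges n = {{u, v} | u v. u < n \<and> v < n \<and> u \<noteq> v}"

definition crossing :: "(nat \<Rightarrow> complex) \<Rightarrow> nat set \<Rightarrow> nat set \<Rightarrow> bool" where
  "crossing p e f \<longleftrightarrow>
    (\<exists>a b c d. e = {a, b} \<and> f = {c, d} \<and>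
       open_segment (p a) (p b) \<inter> open_segment (p c) (p d) \<noteq> {})"

definition is_crossing :: "(nat \<Rightarrow> complex) \<Rightarrow> nat \<Rightarrow> nat set set \<Rightarrow> bool" where
  "is_crossing p l X \<longleftrightarrow> finite X \<and> card X = l \<and> pairwise (crossing p) X"

definition crossing_free :: "(nat \<Rightarrow> complex) \<Rightarrow> nat \<Rightarrow> nat set set \<Rightarrow> bool" where
  "crossing_free p l E \<longleftrightarrow> \<not> (\<exists>X \<subseteq> E. is_crossing p l X)"

definition k_triangulation :: "nat \<Rightarrow> (nat \<Rightarrow> complex) \<Rightarrow> nat \<Rightarrow> nat set set \<Rightarrow> bool" where
  "k_triangulation n p k T \<longleftrightarrow>
    T \<subseteq> all_edges n \<and> crossing_free p (k + 1) T \<and>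
    (\<forall>E. T \<subseteq> E \<and> E \<subseteq> all_edges n \<and> crossing_free p (k + 1) E \<longrightarrow> E = T)"

definition k_relevant_edge :: "nat \<Rightarrow> nat \<Rightarrow> nat \<Rightarrow> nat \<Rightarrow> bool" where
  "k_relevant_edge n k u v \<longleftrightarrow> edge_length n u v > k"

definition k_boundary_edge :: "nat \<Rightarrow> nat \<Rightarrow> nat \<Rightarrow> nat \<Rightarrow> bool" where
  "k_boundary_edge n k u v \<longleftrightarrow> edge_length n u v = k"

text \<open>
  An angle is given by its triple of vertices; the condition \<open>ccw u v w\<close> makes this triple
  uniquely determined by the pair of edges.
\<close>

definition is_angle :: "nat \<Rightarrow> nat set set \<Rightarrow> nat \<Rightarrow> nat \<Rightarrow> nat \<Rightarrow> bool" where
  "is_angle n E u v w \<longleftrightarrow>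
    u < n \<and> v < n \<and> w < n \<and> ccw u v w \<and> {u, v} \<in> E \<and> {v, w} \<in> E \<and>
    \<not> (\<exists>t<n. ccw w t u \<and> {v, t} \<in> E)"

definition k_relevant_angle :: "nat \<Rightarrow> nat \<Rightarrow> nat set set \<Rightarrow> nat \<Rightarrow> nat \<Rightarrow> nat \<Rightarrow> bool" where
  "k_relevant_angle n k E u v w \<longleftrightarrow>
    is_angle n E u v w \<and>
    (k_relevant_edge n k u v \<or> k_boundary_edge n k u v) \<and>
    (k_relevant_edge n k v w \<or> k_boundary_edge n k v w)"

definition k_star :: "nat \<Rightarrow> nat \<Rightarrow> nat set set \<Rightarrow> bool" where
  "k_star n k S \<longleftrightarrow>
    (\<exists>s :: nat \<Rightarrow> nat.
       (\<forall>j<2 * k + 1. s j < n) \<and>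
       (\<forall>i j l. i < j \<longrightarrow> j < l \<longrightarrow> l < 2 * k + 1 \<longrightarrow> ccw (s i) (s j) (s l)) \<and>
       S = {{s j, s ((j + k) mod (2 * k + 1))} | j. j < 2 * k + 1})"

end

theory Submission
  imports Defs
begin

text \<open>
  Everything is lifted to the universal cover \<open>\<int> \<rightarrow> \<int>\<^sub>n\<close>, where the angle becomes \<open>u < v < w < u + n\<close>. A \<open>k\<close>-star
  with this angle consists of vertices \<open>u = a\<^sub>0 < \<dots> < a\<^sub>k = v = b\<^sub>0 < \<dots> < b\<^sub>k = w\<close> and of the edges
  \<open>[a\<^sub>i, b\<^sub>i]\<close> and \<open>[a\<^sub>i, b\<^sub>i\<^sub>+\<^sub>1]\<close>; dropping the second kind of edges gives a ``fan''.

  Existence. The \<open>k\<close>-boundary edges around \<open>v\<close> provide a fan in \<open>T\<close>; take one that maximises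
  \<open>\<Sum>(b\<^sub>i - a\<^sub>i)\<close>. If some \<open>[a\<^sub>i, b\<^sub>i\<^sub>+\<^sub>1]\<close> is missing from \<open>T\<close>, it is crossed by a \<open>k\<close>-crossing
  \<open>f\<^sub>1, \<dots>, f\<^sub>k\<close> of \<open>T\<close> with \<open>f\<^sub>j = [c\<^sub>j, d\<^sub>j]\<close>. As \<open>T\<close> has no \<open>(k+1)\<close>-crossing and no edge inside the angle,
  \<open>f\<^sub>k\<^sub>-\<^sub>i\<close> satisfies \<open>d \<le> w\<close> or, symmetrically, \<open>d \<ge> u + n\<close>. In the first case, replacing
  \<open>[a\<^sub>i\<^sub>+\<^sub>j, b\<^sub>i\<^sub>+\<^sub>j]\<close> by \<open>f\<^sub>j\<close> as long as \<open>d\<^sub>j > b\<^sub>i\<^sub>+\<^sub>j\<close> gives a fan with a larger sum, for otherwise some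
  \<open>[a\<^sub>i\<^sub>+\<^sub>1, b\<^sub>i\<^sub>+\<^sub>1], \<dots>, [a\<^sub>i\<^sub>+\<^sub>j, b\<^sub>i\<^sub>+\<^sub>j], f\<^sub>j, \<dots>, f\<^sub>k\<close> would be a \<open>(k+1)\<close>-crossing.

  Uniqueness. A star contained in \<open>T\<close> dominates every fan of \<open>T\<close> with the same angle, that is, it has
  the smallest \<open>a\<^sub>i\<close> and the largest \<open>b\<^sub>i\<close>; so two stars dominate each other.
\<close>

section \<open>Crossings and fans on the universal cover\<close>

text \<open>
  Every \<open>l\<close>-crossing has exactly such a lift \<open>c\<^sub>0 < \<dots> < c\<^sub>l\<^sub>-\<^sub>1 < d\<^sub>0 < \<dots> < d\<^sub>l\<^sub>-\<^sub>1 < c\<^sub>0 + N\<close>, once the cyclic order has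
  been cut open.
\<close>

definition lcross :: "int \<Rightarrow> (int \<Rightarrow> int \<Rightarrow> bool) \<Rightarrow> nat \<Rightarrow> (nat \<Rightarrow> int) \<Rightarrow> (nat \<Rightarrow> int) \<Rightarrow> bool" where
  "lcross N R l c d \<longleftrightarrow>
    (\<forall>i j. i < j \<longrightarrow> j < l \<longrightarrow> c i < c j \<and> d i < d j) \<and>
    (\<forall>i<l. \<forall>j<l. c i < d j \<and> d j < c i + N) \<and>
    (\<forall>i<l. R (c i) (d i))"

definition fan :: "(int \<Rightarrow> int \<Rightarrow> bool) \<Rightarrow> nat \<Rightarrow> int \<Rightarrow> int \<Rightarrow> int \<Rightarrow> (nat \<Rightarrow> int) \<Rightarrow> (nat \<Rightarrow> int) \<Rightarrow> bool" where
  "fan R k u v w a b \<longleftrightarrow>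
    (\<forall>i j. i < j \<longrightarrow> j \<le> k \<longrightarrow> a i < a j \<and> b i < b j) \<and>
    a 0 = u \<and> b 0 = v \<and> a k = v \<and> b k = w \<and> (\<forall>i\<le>k. R (a i) (b i))"

lemma lcrossI:
  assumes "\<And>i j. i < j \<Longrightarrow> j < l \<Longrightarrow> c i < c j" "\<And>i j. i < j \<Longrightarrow> j < l \<Longrightarrow> d i < d j"
    and "\<And>i j. i < l \<Longrightarrow> j < l \<Longrightarrow> c i < d j" "\<And>i j. i < l \<Longrightarrow> j < l \<Longrightarrow> d j < c i + N"
    and "\<And>i. i < l \<Longrightarrow> R (c i) (d i)"
  shows "lcross N R l c d"
  using assms by (simp add: lcross_def)

lemma lcrossD:
  assumes "lcross N R l c d"
  shows "i < j \<Longrightarrow> j < l \<Longrightarrow> c i < c j" "i < j \<Longrightarrow> j < l \<Longrightarrow> d i < d j"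
    and "i \<le> j \<Longrightarrow> j < l \<Longrightarrow> c i \<le> c j" "i \<le> j \<Longrightarrow> j < l \<Longrightarrow> d i \<le> d j"
    and "i < l \<Longrightarrow> j < l \<Longrightarrow> c i < d j" "i < l \<Longrightarrow> j < l \<Longrightarrow> d j < c i + N"
    and "i < l \<Longrightarrow> R (c i) (d i)"
  using assms unfolding lcross_def by (auto simp: le_less)

lemma fanI:
  assumes "\<And>i j. i < j \<Longrightarrow> j \<le> k \<Longrightarrow> a i < a j" "\<And>i j. i < j \<Longrightarrow> j \<le> k \<Longrightarrow> b i < b j"
    and "a 0 = u" "b 0 = v" "a k = v" "b k = w" "\<And>i. i \<le> k \<Longrightarrow> R (a i) (b i)"
  shows "fan R k u v w a b"
  using assms by (simp add: fan_def)

lemma fanD: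
  assumes "fan R k u v w a b"
  shows "i < j \<Longrightarrow> j \<le> k \<Longrightarrow> a i < a j" "i < j \<Longrightarrow> j \<le> k \<Longrightarrow> b i < b j"
    and "i \<le> j \<Longrightarrow> j \<le> k \<Longrightarrow> a i \<le> a j" "i \<le> j \<Longrightarrow> j \<le> k \<Longrightarrow> b i \<le> b j"
    and "a 0 = u" "b 0 = v" "a k = v" "b k = w"
    and "i \<le> k \<Longrightarrow> R (a i) (b i)"
    and "i \<le> k \<Longrightarrow> u \<le> a i" "i \<le> k \<Longrightarrow> a i \<le> v" "i \<le> k \<Longrightarrow> v \<le> b i" "i \<le> k \<Longrightarrow> b i \<le> w"
proof -
  have A: "i \<le> j \<Longrightarrow> j \<le> k \<Longrightarrow> a i \<le> a j \<and> b i \<le> b j" for i j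
    using assms unfolding fan_def by (cases "i = j") (auto intro: less_imp_le)
  show "i < j \<Longrightarrow> j \<le> k \<Longrightarrow> a i < a j" "i < j \<Longrightarrow> j \<le> k \<Longrightarrow> b i < b j"
    "a 0 = u" "b 0 = v" "a k = v" "b k = w" "i \<le> k \<Longrightarrow> R (a i) (b i)"
    using assms unfolding fan_def by auto
  then show "i \<le> j \<Longrightarrow> j \<le> k \<Longrightarrow> a i \<le> a j" "i \<le> j \<Longrightarrow> j \<le> k \<Longrightarrow> b i \<le> b j"
    "i \<le> k \<Longrightarrow> u \<le> a i" "i \<le> k \<Longrightarrow> a i \<le> v" "i \<le> k \<Longrightarrow> v \<le> b i" "i \<le> k \<Longrightarrow> b i \<le> w"
    using A[of i j] A[of 0 i] A[of i k] by auto
qed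

text \<open>The contradictions with \<open>free\<close> arise by glueing two crossings: the second
  list may follow the first when \<open>c < c' < d < d' < c + N\<close> holds across the
  lists.\<close>

lemma lcross_join:
  assumes "lcross N R l c d" "lcross N R m c' d'"
    and "\<And>i j. i < l \<Longrightarrow> j < m \<Longrightarrow> c i < c' j" "\<And>i j. i < l \<Longrightarrow> j < m \<Longrightarrow> c' j < d i"
    and "\<And>i j. i < l \<Longrightarrow> j < m \<Longrightarrow> d i < d' j" "\<And>i j. i < l \<Longrightarrow> j < m \<Longrightarrow> d' j < c i + N"
  shows "\<exists>c d. lcross N R (l + m) c d"
proof (intro exI)
  show "lcross N R (l + m) (\<lambda>i. if i < l then c i else c' (i - l)) (\<lambda>i. if i < l then d i else d' (i - l))"
  proof (rule lcrossI)
    fix i j assume "i < l + m" "j < l + m"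
    then have "\<not> i < l \<Longrightarrow> i - l < m" "\<not> j < l \<Longrightarrow> j - l < m" by auto
    then show "(if i < l then c i else c' (i - l)) < (if j < l then d j else d' (j - l))"
      using \<open>i < l + m\<close> \<open>j < l + m\<close> assms(3)[of i "j - l"] assms(4)[of j "i - l"] assms(5)[of i "j - l"]
        lcrossD(5)[OF assms(1), of i j] lcrossD(5)[OF assms(2), of "i - l" "j - l"]
        lcrossD(5)[OF assms(1), of i i]
      by auto
    from \<open>\<not> i < l \<Longrightarrow> i - l < m\<close> \<open>\<not> j < l \<Longrightarrow> j - l < m\<close>
    show "(if j < l then d j else d' (j - l)) < (if i < l then c i else c' (i - l)) + N"
      using \<open>i < l + m\<close> \<open>j < l + m\<close> assms(3)[of j "i - l"] assms(6)[of i "j - l"]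
        lcrossD(6)[OF assms(1), of i j] lcrossD(6)[OF assms(2), of "i - l" "j - l"]
        lcrossD(6)[OF assms(1), of j j]
      by auto
  next
    fix i j assume "i < j" "j < l + m"
    then show "(if i < l then c i else c' (i - l)) < (if j < l then c j else c' (j - l))"
      using assms(3)[of i "j - l"] lcrossD(1)[OF assms(1), of i j] lcrossD(1)[OF assms(2), of "i - l" "j - l"]
      by auto
    show "(if i < l then d i else d' (i - l)) < (if j < l then d j else d' (j - l))"
      using \<open>i < j\<close> \<open>j < l + m\<close>
        assms(5)[of i "j - l"] lcrossD(2)[OF assms(1), of i j] lcrossD(2)[OF assms(2), of "i - l" "j - l"]
      by auto
  next
    fix i assume "i < l + m"
    then show "R (if i < l then c i else c' (i - l)) (if i < l then d i else d' (i - l))"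
      using lcrossD(7)[OF assms(1), of i] lcrossD(7)[OF assms(2), of "i - l"] by auto
  qed
qed

lemma lcross_segment:
  assumes "lcross N R l c d" "s + m \<le> l"
  shows "lcross N R m (\<lambda>j. c (s + j)) (\<lambda>j. d (s + j))"
  using assms unfolding lcross_def by auto

text \<open>Fan edges cross each other with one exception: \<open>[a 0, b 0]\<close> and
  \<open>[a k, b k]\<close> share the endpoint \<open>v\<close>. The last hypothesis keeps these two
  from occurring together.\<close>

lemma fan_segment_lcross:
  assumes "fan R k u v w a b" "w < u + N" "s + m \<le> Suc k" "0 < s \<or> m \<le> k"
  shows "lcross N R m (\<lambda>j. a (s + j)) (\<lambda>j. b (s + j))"
proof (rule lcrossI)
  fix i j assume ij: "i < m" "j < m"
  show "a (s + i) < b (s + j)"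
  proof (cases "s + i = k")
    case True
    then have "0 < s + j" using assms ij by auto
    then show ?thesis using fanD(2)[OF assms(1), of 0 "s + j"] fanD(6,7)[OF assms(1)] True ij assms(3) by auto
  next
    case False
    then have "a (s + i) < a k" using fanD(1)[OF assms(1), of "s + i" k] ij assms(3) by auto
    then show ?thesis using fanD(12)[OF assms(1), of "s + j"] fanD(7)[OF assms(1)] ij assms(3) by auto
  qed
  show "b (s + j) < a (s + i) + N"
    using fanD(13)[OF assms(1), of "s + j"] fanD(10)[OF assms(1), of "s + i"] ij assms(2,3) by auto
qed (use fanD[OF assms(1)] assms(3) in auto)

text \<open>Otherwise the fan edges with indices \<open>i + 1, ..., i + 1 + j\<close> followed by
  \<open>[c j, d j], ..., [c (k - 1), d (k - 1)]\<close> form a \<open>(k+1)\<close>-crossing.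
  Indices of \<open>c\<close> and \<open>d\<close> start at \<open>0\<close>, so
  \<open>[c j, d j]\<close> is \<open>f_{j+1}\<close> in the overview.\<close>

lemma fan_prefix_crossing_bound:
  assumes free: "\<nexists>c d. lcross N R (Suc k) c d"
    and fan: "fan R k u v w a b" and wu: "w < u + N" and "i < k"
    and f: "lcross N R k c d"
    and pos: "\<And>j. j < k \<Longrightarrow> a i < c j \<and> c j < b (Suc i) \<and> b (Suc i) < d j \<and> d j < a i + N"
    and j: "i + Suc j \<le> k" "a (i + Suc j) < c j"
  shows "d j \<le> b (i + Suc j)"
proof (rule ccontr)
  assume "\<not> ?thesis"
  then have dj: "b (i + Suc j) < d j" by simp
  note F = fanD[OF fan] and G = lcrossD[OF f]
  have "\<exists>c d. lcross N R (Suc j + (k - j)) c d"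
  proof (rule lcross_join)
    show "lcross N R (Suc j) (\<lambda>m. a (Suc i + m)) (\<lambda>m. b (Suc i + m))"
      using fan_segment_lcross[OF fan wu, of "Suc i" "Suc j"] j by simp
    show "lcross N R (k - j) (\<lambda>m. c (j + m)) (\<lambda>m. d (j + m))"
      using lcross_segment[OF f] j by auto
  next
    fix p q assume pq: "p < Suc j" "q < k - j"
    have "a (Suc i + p) \<le> a (i + Suc j)" "b (Suc i + p) \<le> b (i + Suc j)" "b (Suc i) \<le> b (Suc i + p)"
      "a i \<le> a (Suc i + p)"
      using F(3,4) pq j by auto
    moreover have "c j \<le> c (j + q)" "d j \<le> d (j + q)" using G pq by auto
    ultimately show "a (Suc i + p) < c (j + q)" "c (j + q) < b (Suc i + p)"
      "b (Suc i + p) < d (j + q)" "d (j + q) < a (Suc i + p) + N"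
      using j dj pos[of "j + q"] pq(2) by (auto simp: less_diff_conv2 less_diff_conv add.commute)
  qed
  then show False using free j by simp
qed

section \<open>Enlarging a fan by exchanging edges\<close>

definition spread :: "nat \<Rightarrow> (nat \<Rightarrow> int) \<Rightarrow> (nat \<Rightarrow> int) \<Rightarrow> int" where
  "spread k a b = (\<Sum>i\<le>k. b i - a i)"

text \<open>The edges \<open>[c j, d j]\<close> with \<open>j < L\<close> replace the fan edges with
  indices \<open>i + 1, ..., i + L\<close>. This moves no \<open>a\<close> up and each of these
  \<open>b\<close> up. The order survives because \<open>a i < c 0\<close> and
  \<open>d (L - 1) < d L \<le> b (i + 1 + L)\<close>.\<close>

lemma fan_improve:
  assumes free: "\<nexists>c d. lcross N R (Suc k) c d"
    and fan: "fan R k u v w a b" and wu: "w < u + N" and i: "i < k"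
    and f: "lcross N R k c d"
    and pos: "\<And>j. j < k \<Longrightarrow> a i < c j \<and> c j < b (Suc i) \<and> b (Suc i) < d j \<and> d j < a i + N"
    and q: "d (k - Suc i) \<le> w"
  shows "\<exists>a' b'. fan R k u v w a' b' \<and> spread k a b < spread k a' b'"
proof -
  note F = fanD[OF fan] and G = lcrossD[OF f]
  \<comment> \<open>The first edge whose second end does not pass the fan. It exists since
    \<open>b k = w\<close>, and \<open>i + L < k\<close> leaves \<open>a k\<close> and
    \<open>b k\<close> untouched.\<close>
  define L where "L = (LEAST j. d j \<le> b (i + Suc j))"
  have "d (k - Suc i) \<le> b (i + Suc (k - Suc i))" using q i F(8) by simp
  then have L: "d L \<le> b (i + Suc L)" and Lq: "L \<le> k - Suc i"
    unfolding L_def by (rule LeastI, rule Least_le)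
  have dL: "b (i + Suc j) < d j" if "j < L" for j
    using not_less_Least[of j "\<lambda>j. d j \<le> b (i + Suc j)"] that by (auto simp: L_def)
  have cL: "c j \<le> a (i + Suc j)" if "j < L" for j
    using fan_prefix_crossing_bound[OF free fan wu i f pos, of j] dL[OF that] that Lq i by force
  \<comment> \<open>As \<open>b (Suc i) < d 0\<close>, at least one edge is replaced; this makes the
    increase strict.\<close>
  have "L > 0" using L pos[of 0] i by (cases L) auto
  define a' where "a' m = (if i < m \<and> m \<le> i + L then c (m - Suc i) else a m)" for m
  define b' where "b' m = (if i < m \<and> m \<le> i + L then d (m - Suc i) else b m)" for m
  have le: "a' m \<le> a m" "b m \<le> b' m" for m
    using cL[of "m - Suc i"] dL[of "m - Suc i"] by (auto simp: a'_def b'_def less_imp_le)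
  have "fan R k u v w a' b'"
  proof (rule fanI)
    fix x y :: nat assume xy: "x < y" "y \<le> k"
    show "a' x < a' y"
    proof (cases "i < y \<and> y \<le> i + L")
      case True
      show ?thesis
      proof (cases "i < x")
        case True then show ?thesis using \<open>i < y \<and> y \<le> i + L\<close> xy G(1)[of "x - Suc i" "y - Suc i"]
          by (auto simp: a'_def)
      next
        case False
        have "y - Suc i < k" using True Lq i by auto
        then show ?thesis using \<open>i < y \<and> y \<le> i + L\<close> False xy i F(3)[of x i] pos[of "y - Suc i"]
          by (auto simp: a'_def)
      qed
    next
      case False
      then have "a' y = a y" by (auto simp: a'_def)
      then show ?thesis using le(1)[of x] F(1)[OF xy] by simp
    qed
    show "b' x < b' y"
    proof (cases "i < x \<and> x \<le> i + L")
      case True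
      show ?thesis
      proof (cases "y \<le> i + L")
        case True then show ?thesis using \<open>i < x \<and> x \<le> i + L\<close> xy G(2)[of "x - Suc i" "y - Suc i"]
          by (auto simp: b'_def)
      next
        case False
        have "d (x - Suc i) < d L" using G(2)[of "x - Suc i" L] Lq i True by auto
        also have "\<dots> \<le> b y" using L F(4)[of "i + Suc L" y] False xy by auto
        finally show ?thesis using False True by (auto simp: b'_def)
      qed
    next
      case False
      then have "b' x = b x" by (auto simp: b'_def)
      then show ?thesis using le(2)[of y] F(2)[OF xy] by simp
    qed
  next
    fix x assume "x \<le> k"
    then show "R (a' x) (b' x)" using F(9)[of x] G(7)[of "x - Suc i"] Lq i by (auto simp: a'_def b'_def)
  qed (use F(5-8) Lq i in \<open>auto simp: a'_def b'_def\<close>)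
  moreover have "spread k a b < spread k a' b'"
    unfolding spread_def
  proof (rule sum_strict_mono_ex1)
    show "\<forall>x\<in>{..k}. b x - a x \<le> b' x - a' x" using le by (simp add: diff_mono)
    have "b (Suc i) < b' (Suc i)" using dL[of 0] \<open>L > 0\<close> by (simp add: b'_def)
    then show "\<exists>x\<in>{..k}. b x - a x < b' x - a' x" using le(1)[of "Suc i"] i by (intro bexI[of _ "Suc i"]) auto
  qed simp
  ultimately show ?thesis by blast
qed

text \<open>Negation exchanges the two rows of a fan and reverses them. It reduces the case
  \<open>d \<ge> u + N\<close> of the existence proof to the case \<open>d \<le> w\<close>.\<close>

lemma fan_reflect:
  assumes "fan R k u v w a b" "\<And>x y. R x y = R y x"
  shows "fan (\<lambda>x y. R (- x) (- y)) k (- w) (- v) (- u) (\<lambda>i. - b (k - i)) (\<lambda>i. - a (k - i))"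
  using fanD[OF assms(1)] assms(2) by (intro fanI) auto

lemma spread_reflect: "spread k (\<lambda>i. - b (k - i)) (\<lambda>i. - a (k - i)) = spread k a b"
proof -
  have "spread k (\<lambda>i. - b (k - i)) (\<lambda>i. - a (k - i)) = (\<Sum>i\<le>k. (\<lambda>i. b i - a i) (k - i))"
    by (simp add: spread_def)
  also have "\<dots> = spread k a b"
    unfolding spread_def atMost_atLeast0
    by (rule sum.atLeastAtMost_rev[of "\<lambda>i. b i - a i" 0 k, simplified, symmetric])
  finally show ?thesis .
qed

lemma lcross_reflect:
  assumes "lcross N R l c d" "\<And>x y. R x y = R y x"
  shows "lcross N (\<lambda>x y. R (- x) (- y)) l (\<lambda>i. - d (l - Suc i)) (\<lambda>i. - c (l - Suc i))"
proof (rule lcrossI)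
  fix i j assume "i < l" "j < l"
  then show "- d (l - Suc i) < - c (l - Suc j)" "- c (l - Suc j) < - d (l - Suc i) + N"
    using lcrossD(5,6)[OF assms(1), of "l - Suc j" "l - Suc i"] by auto
qed (use lcrossD[OF assms(1)] assms(2) in auto)

lemma maximal_fan_is_star:
  assumes sym: "\<And>x y. R x y = R y x" and per: "\<And>x y. R (x + N) y = R x y"
    and free: "\<nexists>c d. lcross N R (Suc k) c d"
    and sat: "\<And>x y. x < y \<Longrightarrow> y < x + N \<Longrightarrow> \<not> R x y \<Longrightarrow>
       \<exists>c d. lcross N R k c d \<and> (\<forall>j<k. x < c j \<and> c j < y \<and> y < d j \<and> d j < x + N)"
    and angle: "\<And>t. w < t \<Longrightarrow> t < u + N \<Longrightarrow> \<not> R v t"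
    and fan: "fan R k u v w a b" and wu: "w < u + N" and i: "i < k"
    and max: "\<And>a' b'. fan R k u v w a' b' \<Longrightarrow> spread k a' b' \<le> spread k a b"
  shows "R (a i) (b (Suc i))"
proof (rule ccontr)
  assume nR: "\<not> R (a i) (b (Suc i))"
  note F = fanD[OF fan]
  have "a i < b (Suc i)" "b (Suc i) < a i + N"
    using F(1)[of i k] F(7) F(12)[of "Suc i"] F(13)[of "Suc i"] F(10)[of i] i wu by auto
  from sat[OF this nR] obtain c d where f: "lcross N R k c d"
    and pos: "\<And>j. j < k \<Longrightarrow> a i < c j \<and> c j < b (Suc i) \<and> b (Suc i) < d j \<and> d j < a i + N"
    by blast
  note G = lcrossD[OF f]
  \<comment> \<open>\<open>[c q, d q]\<close> is \<open>f_{k-i}\<close> of the overview: as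
    \<open>i + Suc q = k\<close>, it is the counterpart of \<open>[a k, b k]\<close> here and of
    \<open>[a 0, b 0]\<close> after reflection.\<close>
  define q where "q = k - Suc i"
  have q: "q < k" using i by (simp add: q_def)
  have per2: "R x (y + N) = R x y" for x y using sym per by metis
  have 1: "d q \<le> w" if "v < c q"
    using fan_prefix_crossing_bound[OF free fan wu i f pos, of q] that F(7,8) i by (simp add: q_def)
  \<comment> \<open>Otherwise \<open>f\<^sub>1, \<dots>, f\<^sub>k\<^sub>-\<^sub>i\<close> followed by \<open>[b\<^sub>0, a\<^sub>0 + N], \<dots>, [b\<^sub>i, a\<^sub>i + N]\<close> is a \<open>(k+1)\<close>-crossing.\<close>
  have 2: "u + N \<le> d q" if "c q < v"
  proof (rule ccontr)
    assume "\<not> ?thesis"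
    then have dq: "d q < u + N" by simp
    have "\<exists>c d. lcross N R (Suc q + Suc i) c d"
    proof (rule lcross_join)
      show "lcross N R (Suc q) c d" using lcross_segment[OF f, of 0 "Suc q"] q by simp
      show "lcross N R (Suc i) b (\<lambda>j. a j + N)"
      proof (rule lcrossI)
        fix x y assume "x < Suc i" "y < Suc i"
        then show "b x < a y + N" using F(13)[of x] F(10)[of y] wu i by auto
        have "a y < a k" using F(1)[of y k] \<open>y < Suc i\<close> i by auto
        then show "a y + N < b x + N" using F(12)[of x] F(7) \<open>x < Suc i\<close> i by auto
      qed (use F i per2 sym in auto)
    next
      fix x y assume xy: "x < Suc q" "y < Suc i"
      have "c x \<le> c q" "d x \<le> d q" using G q xy by auto
      moreover have "v \<le> b y" "u \<le> a y" "a y \<le> a i" "b y < b (Suc i)" using F(2,3,10,12) i xy by auto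
      ultimately show "c x < b y" "b y < d x" "d x < a y + N" "a y + N < c x + N"
        using pos[of x] that dq xy q by auto
    qed
    then show False using free i by (simp add: q_def)
  qed
  \<comment> \<open>The remaining value \<open>c q = v\<close> is settled by \<open>angle\<close>:
    no edge at \<open>v\<close> ends strictly between \<open>w\<close> and
    \<open>u + N\<close>.\<close>
  have "d q \<le> w \<or> u + N \<le> d q"
    using 1 2 angle[of "d q"] G(7)[OF q] by (metis linorder_not_le linorder_neqE)
  moreover have "\<not> d q \<le> w"
    using fan_improve[OF free fan wu i f pos] max by (fastforce simp: q_def)
  moreover have "\<not> u + N \<le> d q"
  proof
    assume dq: "u + N \<le> d q"
    \<comment> \<open>The reflected fan misses \<open>[- b (Suc i), - a i]\<close>, at index
      \<open>?i\<close>. Unlike in \<open>lcross_reflect\<close>, \<open>c\<close> and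
      \<open>d\<close> keep their roles: \<open>- c\<close> lies between the ends of that edge, and
      \<open>- d\<close> is moved by one period to lie beyond them.\<close>
    let ?R = "\<lambda>x y. R (- x) (- y)" and ?i = "k - Suc i"
    let ?c = "\<lambda>j. - c (k - Suc j)" and ?d = "\<lambda>j. - d (k - Suc j) + N"
    have free': "\<nexists>c d. lcross N ?R (Suc k) c d"
    proof
      assume "\<exists>c d. lcross N ?R (Suc k) c d"
      then obtain c d where "lcross N ?R (Suc k) c d" by blast
      from lcross_reflect[OF this] free sym show False by auto
    qed
    have f': "lcross N ?R k ?c ?d"
    proof (rule lcrossI)
      fix x assume "x < k"
      then show "?R (?c x) (?d x)"
        using G(7)[of "k - Suc x"] per2[of "c (k - Suc x)" "d (k - Suc x) - N"] by (simp add: algebra_simps)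
    next
      fix x y assume "x < k" "y < k"
      then show "?c x < ?d y" "?d y < ?c x + N"
        using G(5)[of "k - Suc x" "k - Suc y"] G(6)[of "k - Suc x" "k - Suc y"] by auto
    qed (use G in auto)
    have "\<exists>a' b'. fan ?R k (- w) (- v) (- u) a' b' \<and>
      spread k (\<lambda>i. - b (k - i)) (\<lambda>i. - a (k - i)) < spread k a' b'"
    proof (rule fan_improve[OF free' fan_reflect[OF fan sym] _ _ f'])
      fix j assume "j < k"
      then show "- b (k - ?i) < ?c j \<and> ?c j < - a (k - Suc ?i) \<and> - a (k - Suc ?i) < ?d j \<and> ?d j < - b (k - ?i) + N"
        using pos[of "k - Suc j"] i by (simp add: Suc_diff_Suc)
    qed (use wu i dq in \<open>auto simp: q_def\<close>)
    then obtain a' b' where ab': "fan ?R k (- w) (- v) (- u) a' b'" and lt: "spread k a b < spread k a' b'"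
      by (auto simp: spread_reflect)
    have "fan R k u v w (\<lambda>i. - b' (k - i)) (\<lambda>i. - a' (k - i))"
      using fan_reflect[OF ab'] sym by simp
    from max[OF this] lt show False by (simp add: spread_reflect)
  qed
  ultimately show False by blast
qed

section \<open>Existence of fans and of a fan of maximal spread\<close>

lemma maximal_fan_exists:
  assumes "fan R k u v w a b"
  shows "\<exists>a b. fan R k u v w a b \<and> (\<forall>a' b'. fan R k u v w a' b' \<longrightarrow> spread k a' b' \<le> spread k a b)"
proof -
  let ?P = "\<lambda>(a, b). fan R k u v w a b" and ?f = "\<lambda>(a, b). nat (spread k a b)"
  let ?B = "int (Suc k) * (w - u)"
  \<comment> \<open>Every summand lies between \<open>0\<close> and \<open>w - u\<close>, so the
    spreads are bounded and \<open>nat\<close> preserves their comparison.\<close>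
  have bd: "0 \<le> spread k a b \<and> spread k a b \<le> ?B" if "fan R k u v w a b" for a b
  proof -
    note F = fanD[OF that]
    have "0 \<le> b i - a i" "b i - a i \<le> w - u" if "i \<le> k" for i using F(10-13)[OF that] by auto
    then show ?thesis unfolding spread_def
      using sum_mono[of "{..k}" "\<lambda>i. b i - a i" "\<lambda>_. w - u"] by (auto intro!: sum_nonneg)
  qed
  have "\<forall>y. ?P y \<longrightarrow> ?f y < Suc (nat ?B)" using bd by (fastforce simp: nat_le_iff intro!: nat_mono le_imp_less_Suc)
  with ex_has_greatest_nat[of ?P "(a, b)" ?f] assms
  obtain x where x: "?P x" "\<forall>y. ?P y \<longrightarrow> ?f y \<le> ?f x" by (metis case_prodI nat_less_le less_imp_le)
  obtain a0 b0 where "x = (a0, b0)" by fastforce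
  with x have "fan R k u v w a0 b0"
    "\<And>a' b'. fan R k u v w a' b' \<Longrightarrow> nat (spread k a' b') \<le> nat (spread k a0 b0)" by auto
  then show ?thesis using bd by (metis nat_le_eq_zle order_trans)
qed

lemma boundary_fan:
  assumes sat: "\<And>x y. x < y \<Longrightarrow> y < x + N \<Longrightarrow> \<not> R x y \<Longrightarrow>
       \<exists>c d. lcross N R k c d \<and> (\<forall>j<k. x < c j \<and> c j < y \<and> y < d j \<and> d j < x + N)"
    and "0 < k" "int k < N" "u + int k \<le> v" "v + int k \<le> w" "R u v" "R v w"
  shows "\<exists>a b. fan R k u v w a b"
proof -
  \<comment> \<open>Only \<open>k - 1\<close> integers lie strictly between \<open>x\<close> and
    \<open>x + k\<close>, too few for a \<open>k\<close>-crossing, so saturation puts this edge into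
    \<open>R\<close>.\<close>
  have short: "R x (x + int k)" for x
  proof (rule ccontr)
    assume "\<not> R x (x + int k)"
    with sat[of x "x + int k"] assms(2,3) obtain c d where cd: "lcross N R k c d"
      "\<And>j. j < k \<Longrightarrow> x < c j \<and> c j < x + int k" by auto
    have "inj_on c {..<k}" using lcrossD(1)[OF cd(1)] by (metis inj_onI lessThan_iff less_irrefl linorder_neqE_nat)
    moreover have "c ` {..<k} \<subseteq> {x<..<x + int k}" using cd(2) by auto
    ultimately have "k \<le> card {x<..<x + int k}"
      using card_mono[of "{x<..<x + int k}" "c ` {..<k}"] by (simp add: card_image)
    then show False using assms(2) by simp
  qed
  \<comment> \<open>Between the outer edges \<open>[u, v]\<close> and \<open>[v, w]\<close> stand
    the boundary edges \<open>[v - k + i, v + i]\<close>; the distance hypotheses keep both rows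
    increasing at their ends.\<close>
  let ?a = "\<lambda>i. if i = 0 then u else v - int k + int i" and ?b = "\<lambda>i. if i = k then w else v + int i"
  have "fan R k u v w ?a ?b"
  proof (rule fanI)
    fix i assume "i \<le> k"
    then show "R (?a i) (?b i)" using short[of "v - int k + int i"] assms by (auto simp: algebra_simps)
  qed (use assms in auto)
  then show ?thesis by blast
qed

text \<open>The core of uniqueness. In the induction the bound by \<open>b\<close> comes first and
  yields the one by \<open>a\<close>: a violation would allow switching between the star edges
  \<open>[a j, b (Suc j)]\<close> and the edges \<open>[c j, d j]\<close> with one edge too many in
  total.\<close>

lemma star_dominates_fan:
  assumes free: "\<nexists>c d. lcross N R (Suc k) c d"
    and fan: "fan R k u v w a b" and wu: "w < u + N"
    and star: "\<And>i. i < k \<Longrightarrow> R (a i) (b (Suc i))"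
    and fan': "fan R k u v w c d" and "i \<le> k"
  shows "a i \<le> c i \<and> d i \<le> b i"
  using \<open>i \<le> k\<close>
proof (induction i)
  case 0
  then show ?case using fanD(5,6)[OF fan] fanD(5,6)[OF fan'] by simp
next
  case (Suc i)
  note F = fanD[OF fan] and G = fanD[OF fan']
  \<comment> \<open>In contrast to the fan edges these have no exceptional pair, since
    \<open>a j < v < b (Suc j)\<close> for \<open>j < k\<close>.\<close>
  have zigzag: "lcross N R m (\<lambda>j. a (s + j)) (\<lambda>j. b (Suc (s + j)))" if "s + m \<le> k" for s m
  proof (rule lcrossI)
    fix x y assume "x < m" "y < m"
    then have "a (s + x) < a k" "b (Suc (s + y)) \<le> w" "v \<le> b (Suc (s + y))" "u \<le> a (s + x)"
      using F(1)[of "s + x" k] F(10,12,13) that by auto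
    then show "a (s + x) < b (Suc (s + y))" "b (Suc (s + y)) < a (s + x) + N"
      using F(7) wu by auto
  qed (use F star that in auto)
  have "d (Suc i) \<le> b (Suc i)"
  proof (rule ccontr)
    assume lt: "\<not> ?thesis"
    \<comment> \<open>First \<open>[a 0, b 1], ..., [a i, b (i + 1)]\<close>, then
      \<open>[c (i + 1), d (i + 1)], ..., [c k, d k]\<close>. The left ends are in order by the
      induction hypothesis \<open>a i \<le> c i\<close>.\<close>
    have "\<exists>c d. lcross N R (Suc i + (k - i)) c d"
    proof (rule lcross_join)
      show "lcross N R (Suc i) a (\<lambda>j. b (Suc j))" using zigzag[of 0 "Suc i"] Suc.prems by simp
      show "lcross N R (k - i) (\<lambda>j. c (Suc i + j)) (\<lambda>j. d (Suc i + j))"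
        using fan_segment_lcross[OF fan' wu, of "Suc i" "k - i"] Suc.prems by simp
    next
      fix x y assume xy: "x < Suc i" "y < k - i"
      have "a x \<le> a i" "a i \<le> c i" "c i < c (Suc i)" "c (Suc i) \<le> c (Suc i + y)"
        "c (Suc i + y) \<le> v" "v < b (Suc x)" "b (Suc x) \<le> b (Suc i)" "d (Suc i) \<le> d (Suc i + y)"
        "d (Suc i + y) \<le> w" "u \<le> a x"
        using F(3,4,10) F(2)[of 0 "Suc x"] F(6) G(1,3,4,11,13) xy Suc by auto
      then show "a x < c (Suc i + y)" "c (Suc i + y) < b (Suc x)" "b (Suc x) < d (Suc i + y)"
        "d (Suc i + y) < a x + N" using lt wu by auto
    qed
    then show False using free Suc.prems by simp
  qed
  moreover have "a (Suc i) \<le> c (Suc i)"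
  proof (rule ccontr)
    assume lt: "\<not> ?thesis"
    \<comment> \<open>For \<open>Suc i = k\<close> both sides equal \<open>v\<close>.\<close>
    then have i: "Suc i < k" using F(7) G(7) Suc.prems by (cases "Suc i = k") auto
    \<comment> \<open>First \<open>[c 0, d 0], ..., [c (i + 1), d (i + 1)]\<close>, then
      \<open>[a (i + 1), b (i + 2)], ..., [a (k - 1), b k]\<close>. The right ends are in order by
      the bound on \<open>d (Suc i)\<close> just proved.\<close>
    have "\<exists>c d. lcross N R (Suc (Suc i) + (k - Suc i)) c d"
    proof (rule lcross_join)
      show "lcross N R (Suc (Suc i)) c d" using fan_segment_lcross[OF fan' wu, of 0 "Suc (Suc i)"] i by simp
      show "lcross N R (k - Suc i) (\<lambda>j. a (Suc i + j)) (\<lambda>j. b (Suc (Suc i + j)))"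
        using zigzag[of "Suc i" "k - Suc i"] i by simp
    next
      fix x y assume xy: "x < Suc (Suc i)" "y < k - Suc i"
      have "c x \<le> c (Suc i)" "a (Suc i) \<le> a (Suc i + y)" "a (Suc i + y) < a k" "v \<le> d x"
        "d x \<le> d (Suc i)" "b (Suc i) < b (Suc (Suc i + y))" "b (Suc (Suc i + y)) \<le> w" "u \<le> c x"
        using F(1,2,3,13) G(3,4,10,12) xy i by auto
      then show "c x < a (Suc i + y)" "a (Suc i + y) < d x" "d x < b (Suc (Suc i + y))"
        "b (Suc (Suc i + y)) < c x + N"
        using lt wu F(7) \<open>d (Suc i) \<le> b (Suc i)\<close> by auto
    qed
    then show False using free i by simp
  qed
  ultimately show ?case by simp
qed

section \<open>Crossing chords of an inscribed polygon\<close>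

text \<open>Twice the signed area of the triangle, positive for counterclockwise order.\<close>

definition orient :: "complex \<Rightarrow> complex \<Rightarrow> complex \<Rightarrow> real" where
  "orient a b c = (Re b - Re a) * (Im c - Im a) - (Im b - Im a) * (Re c - Re a)"

lemma orient_rotate: "orient b c a = orient a b c"
  and orient_swap: "orient a c b = - orient a b c"
  by (simp_all add: orient_def algebra_simps)

text \<open>The product form shows the sign: for increasing angles spanning less than
  \<open>2 * pi\<close>, all half differences lie strictly between \<open>0\<close> and
  \<open>pi\<close>.\<close>

lemma orient_cis:
  "orient (cis \<alpha>) (cis \<beta>) (cis \<gamma>) = 4 * sin ((\<beta> - \<alpha>) / 2) * sin ((\<gamma> - \<beta>) / 2) * sin ((\<gamma> - \<alpha>) / 2)"
proof -
  define x y where "x = (\<beta> - \<alpha>) / 2" and "y = (\<gamma> - \<beta>) / 2"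
  have eqs: "\<beta> - \<alpha> = 2 * x" "\<gamma> - \<beta> = 2 * y" "\<gamma> - \<alpha> = 2 * (x + y)"
    by (simp_all add: x_def y_def field_simps)
  have "orient (cis \<alpha>) (cis \<beta>) (cis \<gamma>) = sin (\<beta> - \<alpha>) + sin (\<gamma> - \<beta>) - sin (\<gamma> - \<alpha>)"
    by (simp add: orient_def sin_diff algebra_simps)
  also have "\<dots> = 2 * sin x * cos x + 2 * sin y * cos y - 2 * sin (x + y) * cos (x + y)"
    unfolding eqs sin_double by simp
  \<comment> \<open>Each of the two brackets is twice a squared sine.\<close>
  also have "\<dots> = 2 * sin x * cos x * (1 - (cos y)\<^sup>2 + (sin y)\<^sup>2) + 2 * sin y * cos y * (1 - (cos x)\<^sup>2 + (sin x)\<^sup>2)"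
    by (simp add: sin_add cos_add algebra_simps power2_eq_square)
  also have "\<dots> = 4 * sin x * sin y * sin (x + y)"
    by (simp add: cos_squared_eq sin_add) (simp add: algebra_simps power2_eq_square)
  finally have "orient (cis \<alpha>) (cis \<beta>) (cis \<gamma>) = 4 * sin x * sin y * sin (x + y)" .
  moreover have half: "(\<gamma> - \<alpha>) / 2 = x + y" by (simp add: x_def y_def field_simps)
  ultimately show ?thesis unfolding half x_def[symmetric] y_def[symmetric] by blast
qed

section \<open>Cyclic order and intersecting chords\<close>

lemma ccw_rotate: "ccw a b c \<Longrightarrow> ccw b c a"
  by (auto simp: ccw_def)

lemma ccw_asym: "ccw a b c \<Longrightarrow> \<not> ccw a c b"
  by (auto simp: ccw_def)

lemma ccw_distinct: "ccw a b c \<Longrightarrow> a \<noteq> b \<and> b \<noteq> c \<and> a \<noteq> c"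
  by (auto simp: ccw_def)

lemma ccw_total: "a \<noteq> b \<Longrightarrow> b \<noteq> c \<Longrightarrow> a \<noteq> c \<Longrightarrow> ccw a b c \<or> ccw a c b"
  by (auto simp: ccw_def)

lemma orient_pos:
  assumes "inscribed_polygon n p" "a < n" "b < n" "c < n" "ccw a b c"
  shows "orient (p a) (p b) (p c) > 0"
proof -
  obtain \<theta> where \<theta>: "\<And>i j. i < j \<Longrightarrow> j < n \<Longrightarrow> \<theta> i < \<theta> j \<and> \<theta> j < \<theta> i + 2 * pi"
    "\<And>i. i < n \<Longrightarrow> p i = cis (\<theta> i)"
    using assms(1) unfolding inscribed_polygon_def by blast
  have s: "sin ((\<theta> j - \<theta> i) / 2) > 0" if "i < j" "j < n" for i j
    using \<theta>(1)[OF that] by (intro sin_gt_zero) auto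
  have *: "orient (p i) (p j) (p l) > 0" if "i < j" "j < l" "l < n" for i j l
    using that s[of i j] s[of j l] s[of i l] by (simp add: \<theta>(2) orient_cis)
  show ?thesis using assms(2-5) *[of a b c] *[of b c a] *[of c a b] orient_rotate unfolding ccw_def by metis
qed

text \<open>At a common point a convex combination of the orientations of \<open>c\<close> and
  \<open>d\<close> relative to the chord \<open>a, b\<close> vanishes. Among the vertices only
  \<open>a\<close> and \<open>b\<close> have orientation zero and the edges differ, so
  \<open>c\<close> and \<open>d\<close> lie strictly on opposite sides. Conversely, the common point
  is given explicitly.\<close>

lemma open_segments_meet_iff:
  assumes poly: "inscribed_polygon n p" and lt: "a < n" "b < n" "c < n" "d < n"
    and ne: "a \<noteq> b" "c \<noteq> d" "{a, b} \<noteq> {c, d}"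
  shows "open_segment (p a) (p b) \<inter> open_segment (p c) (p d) \<noteq> {} \<longleftrightarrow>
    ccw a c b \<and> ccw b d a \<or> ccw a d b \<and> ccw b c a" (is "?L \<longleftrightarrow> ?R")
proof
  assume ?L
  then obtain x where "x \<in> open_segment (p a) (p b)" "x \<in> open_segment (p c) (p d)" by blast
  then obtain s t :: real where x: "x = (1 - s) *\<^sub>R p a + s *\<^sub>R p b" "x = (1 - t) *\<^sub>R p c + t *\<^sub>R p d"
    and t: "0 < t" "t < 1"
    unfolding in_segment(2) by blast
  have "orient (p a) (p b) ((1 - s) *\<^sub>R p a + s *\<^sub>R p b) = 0"
    by (simp add: orient_def algebra_simps)
  moreover have "orient (p a) (p b) ((1 - t) *\<^sub>R p c + t *\<^sub>R p d) =
      (1 - t) * orient (p a) (p b) (p c) + t * orient (p a) (p b) (p d)"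
    by (simp add: orient_def algebra_simps)
  ultimately have eq: "(1 - t) * orient (p a) (p b) (p c) + t * orient (p a) (p b) (p d) = 0"
    using x by simp
  have zero: "orient (p a) (p b) (p y) = 0" if "y = a \<or> y = b" for y
    using that by (auto simp: orient_def)
  have pos: "orient (p a) (p b) (p y) > 0" if "ccw a b y" "y < n" for y
    using orient_pos[OF poly] that lt by blast
  have neg: "orient (p a) (p b) (p y) < 0" if "ccw a y b" "y < n" for y
    using orient_pos[OF poly, of a y b] that lt orient_swap[of "p a" "p b" "p y"] by simp
  have tri: "y = a \<or> y = b \<or> ccw a b y \<or> ccw a y b" for y using ccw_total[of a b y] ne by blast
  have mix: "(1 - t) * X + t * Y \<noteq> 0" if "0 \<le> X \<and> 0 < Y \<or> 0 < X \<and> 0 \<le> Y \<or> X \<le> 0 \<and> Y < 0 \<or> X < 0 \<and> Y \<le> 0" for X Y :: real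
  proof -
    have "(1 - t) * a + t * b > 0" if "0 \<le> a" "0 \<le> b" "0 < a \<or> 0 < b" for a b :: real
      using that t by (auto intro: add_nonneg_pos add_pos_nonneg)
    from this[of X Y] this[of "- X" "- Y"] that show ?thesis by auto
  qed
  have "ccw a b c \<and> ccw a d b \<or> ccw a c b \<and> ccw a b d"
    using tri[of c] tri[of d] zero[of c] zero[of d] pos[of c] pos[of d] neg[of c] neg[of d] mix eq ne lt
    by (smt (verit) doubleton_eq_iff)
  then show ?R using ccw_rotate by blast
next
  have *: "open_segment (p a) (p b) \<inter> open_segment (p c) (p d) \<noteq> {}"
    if "ccw a c b" "ccw b d a" "c < n" "d < n" for c d
  proof -
    \<comment> \<open>Cutting the quadrilateral \<open>a, c, b, d\<close> along either diagonal
      gives \<open>?A + ?B = ?C + ?D\<close>; these areas are the weights of the intersection point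
      on the two diagonals.\<close>
    let ?A = "orient (p c) (p b) (p d)" and ?B = "orient (p a) (p c) (p d)"
      and ?C = "orient (p a) (p b) (p d)" and ?D = "orient (p a) (p c) (p b)"
    have "ccw c b d" "ccw a c d" "ccw a b d" using that by (auto simp: ccw_def)
    then have P: "?A > 0" "?B > 0" "?C > 0" "?D > 0" using that lt orient_pos[OF poly] by auto
    have S: "?A + ?B = ?C + ?D" by (simp add: orient_def algebra_simps)
    have I: "?A *\<^sub>R p a + ?B *\<^sub>R p b = ?C *\<^sub>R p c + ?D *\<^sub>R p d"
      by (simp add: orient_def complex_eq_iff algebra_simps)
    have "p a \<noteq> p b" "p c \<noteq> p d" using P by (auto simp: orient_def algebra_simps)
    have m: "(1 / (X + Y)) *\<^sub>R (X *\<^sub>R y + Y *\<^sub>R z) \<in> open_segment y z"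
      if "X > 0" "Y > 0" "y \<noteq> z" for X Y and y z :: complex
    proof -
      have "1 - Y / (X + Y) = X / (X + Y)" using that by (simp add: field_simps)
      then have "(1 / (X + Y)) *\<^sub>R (X *\<^sub>R y + Y *\<^sub>R z) = (1 - Y / (X + Y)) *\<^sub>R y + (Y / (X + Y)) *\<^sub>R z"
        by (simp add: scaleR_add_right)
      moreover have "0 < Y / (X + Y)" "Y / (X + Y) < 1" using that by auto
      ultimately show ?thesis using that(3) unfolding in_segment by blast
    qed
    show ?thesis
      using m[OF P(1,2) \<open>p a \<noteq> p b\<close>] m[OF P(3,4) \<open>p c \<noteq> p d\<close>] unfolding S I by blast
  qed
  assume ?R
  then show ?L using *[of c d] *[of d c] lt by (auto simp: open_segment_commute)
qed

lemma crossing_iff: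
  assumes "inscribed_polygon n p" "a < n" "b < n" "c < n" "d < n" "a \<noteq> b" "c \<noteq> d" "{a, b} \<noteq> {c, d}"
  shows "crossing p {a, b} {c, d} \<longleftrightarrow> ccw a c b \<and> ccw b d a \<or> ccw a d b \<and> ccw b c a"
proof -
  have "crossing p {a, b} {c, d} \<longleftrightarrow> open_segment (p a) (p b) \<inter> open_segment (p c) (p d) \<noteq> {}"
  proof
    assume "crossing p {a, b} {c, d}"
    then obtain a' b' c' d' where "{a, b} = {a', b'}" "{c, d} = {c', d'}"
      "open_segment (p a') (p b') \<inter> open_segment (p c') (p d') \<noteq> {}"
      unfolding crossing_def by blast
    then show "open_segment (p a) (p b) \<inter> open_segment (p c) (p d) \<noteq> {}"
      by (auto simp: doubleton_eq_iff open_segment_commute)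
  qed (unfold crossing_def, blast)
  then show ?thesis using open_segments_meet_iff[OF assms] by simp
qed

section \<open>Lifting edges and stars\<close>

text \<open>The covering map \<open>\<int> \<rightarrow> \<int>\<^sub>n\<close>.\<close>

definition vtx :: "nat \<Rightarrow> int \<Rightarrow> nat" where
  "vtx n x = nat (x mod int n)"

lemma vtx_less: "0 < n \<Longrightarrow> vtx n x < n"
  by (simp add: vtx_def nat_less_iff)

lemma vtx_add [simp]: "vtx n (x + int n) = vtx n x"
  by (simp add: vtx_def)

lemma vtx_of_nat: "x < n \<Longrightarrow> vtx n (int x) = x"
  by (simp add: vtx_def)

lemma vtx_eq_iff: "0 < n \<Longrightarrow> vtx n x = vtx n y \<longleftrightarrow> x mod int n = y mod int n"
  by (simp add: vtx_def nat_eq_iff)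

lemma vtx_inj:
  assumes "0 < n" "vtx n y = vtx n z" "x \<le> y" "y < x + int n" "x \<le> z" "z < x + int n"
  shows "y = z"
proof -
  have "int n dvd y - z" using assms by (simp add: vtx_eq_iff mod_eq_dvd_iff)
  moreover have "\<bar>y - z\<bar> < int n" using assms by auto
  ultimately show ?thesis using dvd_imp_le_int[of "y - z" "int n"] by auto
qed

lemma vtx_lift:
  assumes "y < n"
  obtains Y where "x \<le> Y" "Y < x + int n" "vtx n Y = y"
proof
  let ?Y = "x + (int y - x) mod int n"
  show "x \<le> ?Y" "?Y < x + int n" using assms by auto
  have "?Y mod int n = int y" using assms by (simp add: mod_simps)
  then show "vtx n ?Y = y" by (simp add: vtx_def)
qed

text \<open>Once \<open>x\<close> is translated into the range from \<open>0\<close> to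
  \<open>n\<close>, the other two stay below \<open>2 * n\<close> and wrap at most once. Wrapping
  none, both or only \<open>z\<close> gives the three disjuncts of \<open>ccw\<close> in
  turn.\<close>

lemma ccw_vtx:
  assumes "x < y" "y < z" "z < x + int n"
  shows "ccw (vtx n x) (vtx n y) (vtx n z)"
proof -
  have n: "0 < int n" using assms by linarith
  define r where "r t = t - int n * (x div int n)" for t
  have red: "t mod int n = (if r t < int n then r t else r t - int n)" if "0 \<le> r t" "r t < 2 * int n" for t
  proof -
    have "t mod int n = r t mod int n"
      by (metis r_def mod_mult_self2 add.commute diff_add_cancel mult.commute)
    also have "\<dots> = (if r t < int n then r t else r t - int n)"
      using that mod_pos_pos_trivial[of "r t" "int n"] mod_pos_pos_trivial[of "r t - int n" "int n"]
      by (cases "r t < int n") auto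
    finally show ?thesis .
  qed
  have rx: "r x = x mod int n" by (simp add: r_def minus_mult_div_eq_mod)
  then have "0 \<le> r x" "r x < int n" using n by auto
  moreover have "r x < r y" "r y < r z" "r z < r x + int n" using assms by (auto simp: r_def)
  moreover have "y mod int n = (if r y < int n then r y else r y - int n)"
    "z mod int n = (if r z < int n then r z else r z - int n)"
    using calculation by (intro red; linarith)+
  moreover have "ccw (nat a) (nat b) (nat c)"
    if "0 \<le> a" "0 \<le> b" "0 \<le> c" "a < b \<and> b < c \<or> b < c \<and> c < a \<or> c < a \<and> a < b" for a b c :: int
    using that by (auto simp: ccw_def)
  ultimately show ?thesis
    unfolding vtx_def rx[symmetric] by (smt (verit))
qed

lemma ccw_vtx_iff:
  assumes "x < y" "y < x + int n" "x < z" "z < x + int n"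
  shows "ccw (vtx n x) (vtx n y) (vtx n z) \<longleftrightarrow> y < z"
  using assms ccw_vtx[of x y z n] ccw_vtx[of x z y n] ccw_asym ccw_distinct by (metis linorder_neqE)

definition edge :: "nat \<Rightarrow> int \<Rightarrow> int \<Rightarrow> nat set" where
  "edge n x y = {vtx n x, vtx n y}"

lemma vtx_neq: "x < y \<Longrightarrow> y < x + int n \<Longrightarrow> vtx n x \<noteq> vtx n y"
  using vtx_inj[of n x y x] by (cases "n = 0") auto

lemma edge_crossingI:
  assumes poly: "inscribed_polygon n p"
    and "c < c'" "c' < d" "d < d'" "d' < c + int n"
  shows "edge n c d \<noteq> edge n c' d' \<and> crossing p (edge n c d) (edge n c' d')"
proof -
  have n: "0 < n" using assms by linarith
  have V: "vtx n c \<noteq> vtx n c'" "vtx n c' \<noteq> vtx n d" "vtx n c \<noteq> vtx n d" "vtx n c' \<noteq> vtx n d'"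
    using assms by - (rule vtx_neq; linarith)+
  have C: "ccw (vtx n c) (vtx n c') (vtx n d)" "ccw (vtx n d) (vtx n d') (vtx n c)"
    using ccw_vtx[of c c' d n] ccw_vtx[of d d' "c + int n" n] assms by auto
  have ne: "{vtx n c, vtx n d} \<noteq> {vtx n c', vtx n d'}" using V by auto
  show ?thesis
    unfolding edge_def
    using crossing_iff[OF poly vtx_less[OF n] vtx_less[OF n] vtx_less[OF n] vtx_less[OF n] V(3,4) ne] C ne by blast
qed

text \<open>Nested lifts, or lifts with a common end, do not cross. Hence mutually crossing edges
  that all cross one chord are sorted by both ends at once.\<close>

lemma edge_crossingD:
  assumes poly: "inscribed_polygon n p"
    and "x < c" "c < y" "y < d" "d < x + int n" "x < c'" "c' < y" "y < d'" "d' < x + int n"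
    and ne: "edge n c d \<noteq> edge n c' d'"
    and cr: "crossing p (edge n c d) (edge n c' d')"
  shows "c < c' \<and> d < d' \<or> c' < c \<and> d' < d"
proof -
  have n: "0 < n" using assms by linarith
  have V: "vtx n c \<noteq> vtx n d" "vtx n c' \<noteq> vtx n d'"
    using assms by - (rule vtx_neq; linarith)+
  have C: "ccw (vtx n c) (vtx n c') (vtx n d) \<and> ccw (vtx n d) (vtx n d') (vtx n c) \<or>
    ccw (vtx n c) (vtx n d') (vtx n d) \<and> ccw (vtx n d) (vtx n c') (vtx n c)"
    using crossing_iff[OF poly vtx_less[OF n] vtx_less[OF n] vtx_less[OF n] vtx_less[OF n] V] ne cr
    unfolding edge_def by blast
  then have "c \<noteq> c'" "d \<noteq> d'" using ccw_distinct by blast+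
  moreover have False if "c < c'" "d' < d"
    using ccw_vtx[of c c' d n] ccw_vtx[of c d' d n] assms that C ccw_asym ccw_rotate by (smt (verit))
  moreover have False if "c' < c" "d < d'"
    using ccw_vtx[of c d d' n] ccw_vtx[of c d "c' + int n" n] assms that C ccw_asym ccw_rotate
    by (smt (verit) vtx_add)
  ultimately show ?thesis by (cases "c < c'"; cases "d < d'") auto
qed

section \<open>Translation between crossings and their lifts\<close>

lemma lcross_imp_is_crossing:
  assumes poly: "inscribed_polygon n p" and cd: "lcross (int n) (\<lambda>x y. edge n x y \<in> T) l c d"
  shows "\<exists>X\<subseteq>T. is_crossing p l X"
proof (intro exI conjI)
  let ?e = "\<lambda>i. edge n (c i) (d i)"
  note F = lcrossD[OF cd]
  have cr: "?e i \<noteq> ?e j \<and> crossing p (?e i) (?e j)" if "i < j" "j < l" for i j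
    using that F(1,2)[OF that] F(5)[of j i] F(6)[of i j] by (intro edge_crossingI[OF poly]) auto
  have sym: "crossing p e f \<Longrightarrow> crossing p f e" for e f unfolding crossing_def by blast
  show "?e ` {..<l} \<subseteq> T" using F(7) by auto
  have "inj_on ?e {..<l}"
    by (rule inj_onI) (metis cr lessThan_iff linorder_neqE_nat)
  moreover have "pairwise (crossing p) (?e ` {..<l})"
  proof (rule pairwiseI)
    fix e f assume "e \<in> ?e ` {..<l}" "f \<in> ?e ` {..<l}" "e \<noteq> f"
    then obtain i j where "e = ?e i" "f = ?e j" "i < l" "j < l" "i \<noteq> j" by blast
    then show "crossing p e f" using cr[of i j] cr[of j i] sym by (cases i j rule: linorder_cases) auto
  qed
  ultimately show "is_crossing p l (?e ` {..<l})" by (simp add: is_crossing_def card_image)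
qed

lemma edge_in_all_edges: "x < y \<Longrightarrow> y < x + int n \<Longrightarrow> edge n x y \<in> all_edges n"
  unfolding all_edges_def edge_def using vtx_neq[of x y n] vtx_less[of n]
  by (cases "n = 0") auto

text \<open>A crossing edge has one end on each of the two arcs cut off by \<open>[x, y]\<close>;
  both are lifted to the window from \<open>x\<close> to \<open>x + n\<close>.\<close>

lemma crossing_edge_lift:
  assumes poly: "inscribed_polygon n p" and xy: "x < y" "y < x + int n"
    and f: "f \<in> all_edges n" "f \<noteq> edge n x y" "crossing p (edge n x y) f"
  shows "\<exists>c d. f = edge n c d \<and> x < c \<and> c < y \<and> y < d \<and> d < x + int n"
proof -
  have n: "0 < n" using xy by linarith
  obtain g h where gh: "f = {g, h}" "g < n" "h < n" "g \<noteq> h" using f(1) by (auto simp: all_edges_def)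
  have "ccw (vtx n x) g (vtx n y) \<and> ccw (vtx n y) h (vtx n x) \<or> ccw (vtx n x) h (vtx n y) \<and> ccw (vtx n y) g (vtx n x)"
    using crossing_iff[OF poly vtx_less[OF n] vtx_less[OF n] gh(2,3) vtx_neq[OF xy] gh(4)] f gh(1)
    by (auto simp: edge_def)
  then obtain g' h' where gh': "f = {g', h'}" "g' < n" "h' < n"
    "ccw (vtx n x) g' (vtx n y)" "ccw (vtx n y) h' (vtx n x)"
    using gh by (metis insert_commute)
  obtain c where c: "x \<le> c" "c < x + int n" "vtx n c = g'" using vtx_lift gh'(2) by blast
  obtain d where d: "x \<le> d" "d < x + int n" "vtx n d = h'" using vtx_lift gh'(3) by blast
  have "x \<noteq> c" "x \<noteq> d" "d \<noteq> y" using gh'(4,5) c d ccw_distinct by blast+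
  then have "x < c" "x < d" using c d by auto
  then have "c < y" using gh'(4) c xy ccw_vtx_iff by blast
  moreover have "y < d" using gh'(5) \<open>x < d\<close> d xy ccw_vtx_iff[of x y n d] ccw_rotate by blast
  ultimately show ?thesis using \<open>x < c\<close> c d gh'(1) unfolding edge_def by blast
qed

lemma finite_enumerate_by_key:
  fixes C :: "'a \<Rightarrow> 'b :: linorder"
  assumes "finite Y" "inj_on C Y"
  shows "\<exists>g. (\<forall>i<card Y. g i \<in> Y) \<and> (\<forall>i j. i < j \<longrightarrow> j < card Y \<longrightarrow> C (g i) < C (g j))"
proof (intro exI conjI allI impI)
  let ?L = "sorted_list_of_set (C ` Y)"
  have len: "length ?L = card Y" using assms by (simp add: card_image)
  have mem: "?L ! i \<in> C ` Y" if "i < card Y" for i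
    using that len nth_mem[of i ?L] assms(1) by simp
  show "inv_into Y C (?L ! i) \<in> Y" if "i < card Y" for i
    using mem[OF that] by (rule inv_into_into)
  show "C (inv_into Y C (?L ! i)) < C (inv_into Y C (?L ! j))" if "i < j" "j < card Y" for i j
    using mem[of i] mem[of j] that len sorted_wrt_nth_less[OF strict_sorted_list_of_set[of "C ` Y"] that(1)]
    by (simp add: f_inv_into_f)
qed

text \<open>By maximality the missing edge completes a \<open>(k+1)\<close>-crossing, which must use
  it as \<open>T\<close> has none. The other \<open>k\<close> edges all cross it, and
  \<open>edge_crossingD\<close> lets them be listed with both ends increasing.\<close>

lemma k_triangulation_saturated:
  assumes poly: "inscribed_polygon n p" and T: "k_triangulation n p k T"
    and xy: "x < y" "y < x + int n" and nT: "edge n x y \<notin> T"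
  shows "\<exists>c d. lcross (int n) (\<lambda>x y. edge n x y \<in> T) k c d \<and>
    (\<forall>j<k. x < c j \<and> c j < y \<and> y < d j \<and> d j < x + int n)"
proof -
  let ?e = "edge n x y"
  have T1: "T \<subseteq> all_edges n" "crossing_free p (k + 1) T"
    and max: "\<And>E. T \<subseteq> E \<Longrightarrow> E \<subseteq> all_edges n \<Longrightarrow> crossing_free p (k + 1) E \<Longrightarrow> E = T"
    using T unfolding k_triangulation_def by blast+
  have "\<not> crossing_free p (k + 1) (insert ?e T)"
    using max[of "insert ?e T"] nT edge_in_all_edges[OF xy] T1(1) by blast
  then obtain X where X: "X \<subseteq> insert ?e T" "finite X" "card X = k + 1" "pairwise (crossing p) X"
    unfolding crossing_free_def is_crossing_def by blast
  have e: "?e \<in> X" using X T1(2) unfolding crossing_free_def is_crossing_def by blast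
  define Y where "Y = X - {?e}"
  have Y: "Y \<subseteq> T" "finite Y" "card Y = k" using X e by (auto simp: Y_def)
  have "\<exists>c d. f = edge n c d \<and> x < c \<and> c < y \<and> y < d \<and> d < x + int n" if "f \<in> Y" for f
    using that T1(1) Y(1) X(4) e
    by (intro crossing_edge_lift[OF poly xy]) (auto simp: Y_def pairwise_def)
  then obtain C D where CD: "\<And>f. f \<in> Y \<Longrightarrow> f = edge n (C f) (D f) \<and>
      x < C f \<and> C f < y \<and> y < D f \<and> D f < x + int n" by metis
  have cmp: "C f < C g \<and> D f < D g \<or> C g < C f \<and> D g < D f" if "f \<in> Y" "g \<in> Y" "f \<noteq> g" for f g
  proof (rule edge_crossingD[OF poly])
    have "crossing p f g" using that X(4) by (auto simp: Y_def pairwise_def)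
    then show "crossing p (edge n (C f) (D f)) (edge n (C g) (D g))" using CD that by metis
    show "edge n (C f) (D f) \<noteq> edge n (C g) (D g)" using CD that by metis
  qed (use CD that in auto)
  have "inj_on C Y" by (rule inj_onI) (metis cmp less_irrefl)
  from finite_enumerate_by_key[OF Y(2) this] obtain g where
    g: "\<And>i. i < k \<Longrightarrow> g i \<in> Y" "\<And>i j. i < j \<Longrightarrow> j < k \<Longrightarrow> C (g i) < C (g j)" unfolding Y(3) by blast
  have "lcross (int n) (\<lambda>x y. edge n x y \<in> T) k (C \<circ> g) (D \<circ> g)"
  proof (rule lcrossI)
    fix i j assume ij: "i < j" "j < k"
    then have "C (g i) < C (g j)" using g by blast
    moreover from this have "g i \<noteq> g j" by auto
    ultimately show "(C \<circ> g) i < (C \<circ> g) j" "(D \<circ> g) i < (D \<circ> g) j"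
      using cmp[of "g i" "g j"] g(1)[of i] g(1)[of j] ij by auto
  next
    fix i j assume "i < k" "j < k"
    then show "(C \<circ> g) i < (D \<circ> g) j" "(D \<circ> g) j < (C \<circ> g) i + int n"
      using CD[of "g i"] CD[of "g j"] g(1) by force+
  next
    fix i assume "i < k"
    then show "edge n ((C \<circ> g) i) ((D \<circ> g) i) \<in> T" using CD[of "g i"] g(1)[of i] Y(1) by auto
  qed
  then show ?thesis using CD g(1) by (intro exI[of _ "C \<circ> g"] exI[of _ "D \<circ> g"]) auto
qed

text \<open>The interval is the bijective image of \<open>{x..<y}\<close>; this turns edge lengths
  into distances in the cover.\<close>

lemma card_cyclic_interval:
  assumes "x < y" "y < x + int n"
  shows "int (card (cyclic_interval n (vtx n x) (vtx n y))) = y - x"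
proof -
  have n: "0 < n" using assms by linarith
  have "cyclic_interval n (vtx n x) (vtx n y) = vtx n ` {x..<y}"
  proof (rule set_eqI)
    fix t
    show "t \<in> cyclic_interval n (vtx n x) (vtx n y) \<longleftrightarrow> t \<in> vtx n ` {x..<y}"
    proof
      assume t: "t \<in> cyclic_interval n (vtx n x) (vtx n y)"
      then have "t < n" by (simp add: cyclic_interval_def)
      then obtain z where z: "x \<le> z" "z < x + int n" "vtx n z = t" using vtx_lift by blast
      then show "t \<in> vtx n ` {x..<y}"
        using t ccw_vtx_iff[of x z n y] assms by (cases "z = x") (auto simp: cyclic_interval_def)
    next
      assume "t \<in> vtx n ` {x..<y}"
      then obtain z where "x \<le> z" "z < y" "t = vtx n z" by auto
      then show "t \<in> cyclic_interval n (vtx n x) (vtx n y)"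
        using ccw_vtx[of x z y n] assms vtx_less[OF n] by (cases "z = x") (auto simp: cyclic_interval_def)
    qed
  qed
  moreover have "inj_on (vtx n) {x..<y}"
    using vtx_inj[OF n, of _ _ x] assms by (intro inj_onI) auto
  ultimately show ?thesis using assms by (simp add: card_image)
qed

section \<open>Stars in the cover\<close>

definition star_edges :: "nat \<Rightarrow> nat \<Rightarrow> (nat \<Rightarrow> int) \<Rightarrow> (nat \<Rightarrow> int) \<Rightarrow> nat set set" where
  "star_edges n k a b = {edge n (a i) (b i) | i. i \<le> k} \<union> {edge n (a i) (b (Suc i)) | i. i < k}"

lemma k_star_star_edges:
  assumes fan: "fan R k u v w a b" and wu: "w < u + int n"
  shows "k_star n k (star_edges n k a b)"
proof -
  note F = fanD[OF fan]
  \<comment> \<open>All \<open>2 * k + 1\<close> vertices in increasing order; the common value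
    \<open>a k = b 0\<close> is listed once.\<close>
  define \<tau> where "\<tau> j = (if j \<le> k then a j else b (j - k))" for j
  have n: "0 < n" using F(10)[of 0] F(11)[of 0] F(12)[of k] F(8) wu by auto
  have \<tau>_mono: "\<tau> i < \<tau> j" if "i < j" "j < 2 * k + 1" for i j
  proof (cases "i \<le> k \<and> k < j")
    case True
    moreover have "j - k \<le> k" using that by linarith
    ultimately show ?thesis using F(11)[of i] F(2)[of 0 "j - k"] F(6) by (auto simp: \<tau>_def)
  next
    case False
    then show ?thesis using F(1)[of i j] F(2)[of "i - k" "j - k"] that by (auto simp: \<tau>_def)
  qed
  have \<tau>_bound: "u \<le> \<tau> i \<and> \<tau> i \<le> w" if "i < 2 * k + 1" for i
  proof -
    have "i - k \<le> k" using that by linarith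
    then show ?thesis
      using F(10-13)[of i] F(10-13)[of "i - k"] F(10-13)[of 0] by (auto simp: \<tau>_def)
  qed
  \<comment> \<open>For \<open>j \<le> k\<close> the partner of \<open>a j\<close> is
    \<open>b j\<close>; for \<open>j > k\<close> the index wraps around and \<open>b (j - k)\<close>
    is joined to \<open>a (j - k - 1)\<close>.\<close>
  have mod: "(j + k) mod (2 * k + 1) = (if j \<le> k then j + k else j - Suc k)" if "j < 2 * k + 1" for j
    using that by (auto simp: mod_if)
  have \<tau>b: "\<tau> (j + k) = b j" for j using F(6,7) by (auto simp: \<tau>_def)
  have "star_edges n k a b = {{vtx n (\<tau> j), vtx n (\<tau> ((j + k) mod (2 * k + 1)))} | j. j < 2 * k + 1}"
    (is "_ = ?S")
  proof
    have "edge n (a i) (b i) \<in> ?S" if "i \<le> k" for i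
      using that mod[of i] \<tau>b[of i] by (intro CollectI exI[of _ i]) (auto simp: \<tau>_def edge_def)
    moreover have "edge n (a i) (b (Suc i)) \<in> ?S" if "i < k" for i
      using that mod[of "Suc i + k"] \<tau>b[of "Suc i"]
      by (intro CollectI exI[of _ "Suc i + k"]) (auto simp: \<tau>_def edge_def)
    ultimately show "star_edges n k a b \<subseteq> ?S" unfolding star_edges_def by blast
  next
    have "{vtx n (\<tau> j), vtx n (\<tau> ((j + k) mod (2 * k + 1)))} \<in> star_edges n k a b" if "j < 2 * k + 1" for j
    proof (cases "j \<le> k")
      case True
      then show ?thesis using mod[OF that] \<tau>b[of j] unfolding star_edges_def edge_def
        by (intro UnI1 CollectI exI[of _ j]) (auto simp: \<tau>_def)
    next
      case False
      then have "Suc (j - Suc k) = j - k" by auto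
      then show ?thesis using False that mod[OF that] unfolding star_edges_def edge_def
        by (intro UnI2 CollectI exI[of _ "j - Suc k"]) (auto simp: \<tau>_def)
    qed
    then show "?S \<subseteq> star_edges n k a b" by auto
  qed
  moreover have "ccw (vtx n (\<tau> i)) (vtx n (\<tau> j)) (vtx n (\<tau> l))" if "i < j" "j < l" "l < 2 * k + 1" for i j l
    using \<tau>_mono[of i j] \<tau>_mono[of j l] \<tau>_bound[of i] \<tau>_bound[of l] that wu by (intro ccw_vtx) auto
  ultimately show ?thesis
    unfolding k_star_def using vtx_less[OF n] by (intro exI[of _ "vtx n \<circ> \<tau>"]) auto
qed

text \<open>Unrolling removes the reduction modulo \<open>2 * k + 1\<close>: one turn through the
  star's vertices adds \<open>n\<close>, and edges join positions at distance
  \<open>k\<close>.\<close>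

lemma k_star_cover:
  assumes "k_star n k S" "1 \<le> k"
  shows "\<exists>\<sigma> :: nat \<Rightarrow> int. strict_mono \<sigma> \<and> (\<forall>m. \<sigma> (m + (2 * k + 1)) = \<sigma> m + int n) \<and>
    S = {edge n (\<sigma> m) (\<sigma> (m + k)) | m. True}"
proof -
  define K where "K = 2 * k + 1"
  have K: "K \<ge> 3" using assms(2) by (simp add: K_def)
  obtain s where s: "\<And>j. j < K \<Longrightarrow> s j < n"
    "\<And>i j l. i < j \<Longrightarrow> j < l \<Longrightarrow> l < K \<Longrightarrow> ccw (s i) (s j) (s l)"
    "S = {{s j, s ((j + k) mod K)} | j. j < K}"
    using assms(1) unfolding k_star_def K_def by blast
  have "\<exists>Y. int (s 0) \<le> Y \<and> Y < int (s 0) + int n \<and> vtx n Y = s j" if "j < K" for j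
    using vtx_lift[OF s(1)[OF that]] by metis
  then obtain \<rho> where \<rho>: "\<And>j. j < K \<Longrightarrow> int (s 0) \<le> \<rho> j \<and> \<rho> j < int (s 0) + int n \<and> vtx n (\<rho> j) = s j"
    by metis
  have s0: "vtx n (int (s 0)) = s 0" using s(1)[of 0] K by (simp add: vtx_of_nat)
  have \<rho>0: "\<rho> 0 = int (s 0)"
    using vtx_inj[of n "\<rho> 0" "int (s 0)" "int (s 0)"] \<rho>[of 0] s0 s(1)[of 0] K by auto
  have pos: "\<rho> 0 < \<rho> j" if "0 < j" "j < K" for j
  proof -
    \<comment> \<open>\<open>ccw\<close> speaks of triples, so a third vertex is needed to separate
      \<open>s 0\<close> from \<open>s j\<close>: it is \<open>s 2\<close> for \<open>j = 1\<close>
      and \<open>s 1\<close> otherwise.\<close>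
    have "s 0 \<noteq> s j"
      using s(2)[of 0 j 2] s(2)[of 0 1 j] that K ccw_distinct by (cases "j = 1") auto
    then have "\<rho> j \<noteq> \<rho> 0" using \<rho>[of 0] \<rho>[of j] that by auto
    then show ?thesis using \<rho>[of j] \<rho>0 that by auto
  qed
  have mono: "\<rho> i < \<rho> j" if "i < j" "j < K" for i j
  proof (cases "i = 0")
    case True then show ?thesis using pos that by auto
  next
    case False
    have "ccw (vtx n (\<rho> 0)) (vtx n (\<rho> i)) (vtx n (\<rho> j))"
      using s(2)[of 0 i j] \<rho>[of 0] \<rho>[of i] \<rho>[of j] that False by auto
    then show ?thesis
      using ccw_vtx_iff[of "\<rho> 0" "\<rho> i" n "\<rho> j"] pos[of i] pos[of j] \<rho>[of i] \<rho>[of j] \<rho>0 that False by auto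
  qed
  define \<sigma> where "\<sigma> m = \<rho> (m mod K) + int n * int (m div K)" for m
  have K0: "0 < K" using K by simp
  have vtx\<sigma>: "vtx n (\<sigma> m) = s (m mod K)" for m
  proof -
    have "vtx n (\<sigma> m) = vtx n (\<rho> (m mod K))" by (simp add: vtx_def \<sigma>_def)
    then show ?thesis using \<rho>[of "m mod K"] K0 by simp
  qed
  have "strict_mono \<sigma>"
    unfolding strict_mono_Suc_iff
  proof
    fix m
    show "\<sigma> m < \<sigma> (Suc m)"
    proof (cases "Suc (m mod K) = K")
      case True
      then show ?thesis using \<rho>[of "m mod K"] \<rho>0 K0
        by (simp add: \<sigma>_def mod_Suc div_Suc algebra_simps)
    next
      case False
      moreover have "Suc (m mod K) < K" using False K0 mod_less_divisor[of K m] by linarith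
      ultimately show ?thesis using mono[of "m mod K" "Suc (m mod K)"] K0
        by (auto simp: \<sigma>_def mod_Suc div_Suc)
    qed
  qed
  moreover have "\<sigma> (m + K) = \<sigma> m + int n" for m
    using K0 by (simp add: \<sigma>_def algebra_simps)
  moreover have "S = {edge n (\<sigma> m) (\<sigma> (m + k)) | m. True}"
  proof -
    have "edge n (\<sigma> m) (\<sigma> (m + k)) = {s (m mod K), s ((m mod K + k) mod K)}" for m
      by (simp add: edge_def vtx\<sigma> mod_simps)
    then show ?thesis unfolding s(3) using mod_less_divisor[OF K0] by (auto, metis mod_less)
  qed
  ultimately show ?thesis unfolding K_def by blast
qed

text \<open>The unrolled star is re-indexed to put \<open>v\<close> at position \<open>k\<close>.
  Its only neighbours are \<open>k\<close> positions before and after, so \<open>u\<close> and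
  \<open>w\<close> sit at \<open>0\<close> and \<open>2 * k\<close>, and the fan can be read
  off.\<close>

lemma k_star_angle_fan:
  assumes star: "k_star n k S" and k: "1 \<le> k" and uvw: "u < v" "v < w" "w < u + int n"
    and e: "edge n u v \<in> S" "edge n v w \<in> S"
  shows "\<exists>a b. fan (\<lambda>x y. edge n x y \<in> S) k u v w a b \<and> S = star_edges n k a b"
proof -
  have n: "0 < n" using uvw by linarith
  obtain \<sigma> where mono: "strict_mono \<sigma>" and per: "\<And>m. \<sigma> (m + (2 * k + 1)) = \<sigma> m + int n"
    and S: "S = {edge n (\<sigma> m) (\<sigma> (m + k)) | m. True}"
    using k_star_cover[OF star k] by blast
  have per': "\<sigma> (m + (2 * k + 1) * q) = \<sigma> m + int n * int q" for m q
  proof (induction q)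
    case (Suc q)
    have "m + (2 * k + 1) * Suc q = m + (2 * k + 1) * q + (2 * k + 1)" by simp
    then have "\<sigma> (m + (2 * k + 1) * Suc q) = \<sigma> (m + (2 * k + 1) * q) + int n" using per by presburger
    then show ?case using Suc by (simp add: algebra_simps)
  qed simp
  have vper: "vtx n (\<sigma> (m + (2 * k + 1) * q)) = vtx n (\<sigma> m)" for m q
    unfolding per' by (simp add: vtx_def)
  have vcong: "vtx n (\<sigma> m) = vtx n (\<sigma> m')" if "m mod (2 * k + 1) = m' mod (2 * k + 1)" for m m'
    using vper[of "m mod (2 * k + 1)" "m div (2 * k + 1)"] vper[of "m' mod (2 * k + 1)" "m' div (2 * k + 1)"] that
    unfolding mod_mult_div_eq by metis
  obtain m0 where "vtx n v = vtx n (\<sigma> m0)"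
    using e(1) unfolding S edge_def by (auto simp: doubleton_eq_iff)
  then have m0: "vtx n v = vtx n (\<sigma> (m0 + (2 * k + 1)))" using vper[of m0 1] by simp
  \<comment> \<open>A full period is added to the position \<open>m0\<close> of \<open>v\<close>, so
    that going back \<open>k\<close> steps needs no negative index. The translation in
    \<open>\<tau>\<close> is by a multiple of \<open>n\<close>.\<close>
  define M where "M = m0 + (k + 1)"
  define \<tau> where "\<tau> i = \<sigma> (M + i) + (v - \<sigma> (M + k))" for i
  have \<tau>k: "\<tau> k = v" by (simp add: \<tau>_def)
  have \<tau>_mono: "i < j \<Longrightarrow> \<tau> i < \<tau> j" for i j using mono by (simp add: \<tau>_def strict_mono_def)
  have \<tau>_per: "\<tau> (i + (2 * k + 1)) = \<tau> i + int n" for i using per[of "M + i"] by (simp add: \<tau>_def add.assoc)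
  have Mk: "M + k = m0 + (2 * k + 1)" by (simp add: M_def)
  have "int n dvd v - \<sigma> (M + k)" unfolding Mk using m0 n by (simp add: vtx_eq_iff mod_eq_dvd_iff)
  then have v\<tau>: "vtx n (\<tau> i) = vtx n (\<sigma> (M + i))" for i
    unfolding \<tau>_def vtx_def by (metis mod_add_right_eq dvd_eq_mod_eq_0 add.right_neutral)
  have S\<tau>: "S = {edge n (\<tau> i) (\<tau> (i + k)) | i. i < 2 * k + 1}"
  proof
    show "{edge n (\<tau> i) (\<tau> (i + k)) | i. i < 2 * k + 1} \<subseteq> S"
      unfolding S edge_def v\<tau> by (auto simp: add.assoc)
    have "edge n (\<sigma> m) (\<sigma> (m + k)) \<in> {edge n (\<tau> i) (\<tau> (i + k)) | i. i < 2 * k + 1}" for m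
    proof -
      \<comment> \<open>Adding a multiple of the period keeps the subtraction on naturals exact and
        the residue unchanged.\<close>
      let ?i = "(m + (2 * k + 1) * M - M) mod (2 * k + 1)"
      have "M \<le> m + (2 * k + 1) * M" by simp
      then have eq: "(M + ?i) mod (2 * k + 1) = m mod (2 * k + 1)"
        by (metis mod_add_right_eq le_add_diff_inverse mod_mult_self2)
      then have "(M + ?i + k) mod (2 * k + 1) = (m + k) mod (2 * k + 1)"
        by (metis mod_add_left_eq)
      with eq have "edge n (\<sigma> m) (\<sigma> (m + k)) = edge n (\<tau> ?i) (\<tau> (?i + k))"
        unfolding edge_def v\<tau> using vcong by (metis add.assoc)
      moreover have "?i < 2 * k + 1" by (rule mod_less_divisor) simp
      ultimately show ?thesis by blast
    qed
    then show "S \<subseteq> {edge n (\<tau> i) (\<tau> (i + k)) | i. i < 2 * k + 1}" unfolding S by blast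
  qed
  have nb: "x = \<tau> (2 * k) \<or> x = \<tau> 0 + int n" if x: "v < x" "x < v + int n" "edge n v x \<in> S" for x
  proof -
    obtain i where i: "i < 2 * k + 1" "{vtx n v, vtx n x} = {vtx n (\<tau> i), vtx n (\<tau> (i + k))}"
      using x(3) unfolding S\<tau> edge_def by auto
    have le: "\<tau> p \<le> \<tau> q" if "p \<le> q" for p q using \<tau>_mono[of p q] that by (cases "p = q") auto
    have inj: "p = q" if "vtx n (\<tau> p) = vtx n (\<tau> q)" "r \<le> p" "p < r + (2 * k + 1)" "r \<le> q" "q < r + (2 * k + 1)" for p q r
    proof -
      have "\<tau> p = \<tau> q"
        using vtx_inj[OF n that(1), of "\<tau> r"] le[of r p] le[of r q]
          \<tau>_mono[of p "r + (2 * k + 1)"] \<tau>_mono[of q "r + (2 * k + 1)"] \<tau>_per[of r] that by linarith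
      then show ?thesis using \<tau>_mono by (metis less_irrefl linorder_neqE_nat)
    qed
    have xeq: "x = y" if "vtx n x = vtx n y" "v \<le> y" "y < v + int n" for y
      using vtx_inj[OF n that(1), of v] x that by auto
    from i(2) consider "vtx n v = vtx n (\<tau> i)" "vtx n x = vtx n (\<tau> (i + k))"
      | "vtx n v = vtx n (\<tau> (i + k))" "vtx n x = vtx n (\<tau> i)" by (auto simp: doubleton_eq_iff)
    then show ?thesis
    proof cases
      case 1
      then have "i = k" using inj[of k i 0] i(1) \<tau>k by simp
      moreover have "\<tau> (2 * k) < \<tau> (k + (2 * k + 1))" by (rule \<tau>_mono) simp
      ultimately show ?thesis using xeq[of "\<tau> (2 * k)"] 1(2) le[of k "2 * k"] \<tau>k \<tau>_per[of k] by (simp add: mult_2)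
    next
      case 2
      then have "i + k = k" using inj[of k "i + k" k] i(1) \<tau>k by simp
      then have "vtx n x = vtx n (\<tau> 0 + int n)" using 2(2) by simp
      moreover have "\<tau> k \<le> \<tau> (0 + (2 * k + 1))" "\<tau> 0 < \<tau> k" using le \<tau>_mono k by auto
      ultimately show ?thesis using xeq[of "\<tau> 0 + int n"] \<tau>k \<tau>_per[of 0] by simp
    qed
  qed
  \<comment> \<open>Of the two candidates \<open>\<tau> (2 * k) < \<tau> 0 + n\<close>, the smaller
    is \<open>w\<close> and the larger \<open>u + n\<close>, as \<open>w < u + n\<close>.\<close>
  have "edge n v (u + int n) \<in> S" using e(1) by (simp add: edge_def insert_commute)
  then have "w = \<tau> (2 * k) \<and> u = \<tau> 0"
    using nb[of w] nb[of "u + int n"] uvw e(2) \<tau>_mono[of "2 * k" "0 + (2 * k + 1)"] \<tau>_per[of 0] by auto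
  moreover have in1: "edge n (\<tau> i) (\<tau> (k + i)) \<in> S" if "i \<le> k" for i
    unfolding S\<tau> using that by (intro CollectI exI[of _ i]) (auto simp: add.commute)
  ultimately have "fan (\<lambda>x y. edge n x y \<in> S) k u v w \<tau> (\<lambda>i. \<tau> (k + i))"
    using \<tau>_mono \<tau>k by (intro fanI) (auto simp: mult_2)
  moreover have "S = star_edges n k \<tau> (\<lambda>i. \<tau> (k + i))"
  proof -
    \<comment> \<open>Edges starting beyond position \<open>k\<close> end in the next period; modulo
      \<open>n\<close> they are the edges \<open>[a i, b (Suc i)]\<close>.\<close>
    have wrap: "edge n (\<tau> (k + Suc i)) (\<tau> (k + Suc i + k)) = edge n (\<tau> i) (\<tau> (k + Suc i))" for i
    proof -
      have "\<tau> (k + Suc i + k) = \<tau> i + int n" using \<tau>_per[of i] by (simp add: add.commute add.left_commute mult_2)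
      then show ?thesis unfolding edge_def by auto
    qed
    have "edge n (\<tau> i) (\<tau> (i + k)) \<in> star_edges n k \<tau> (\<lambda>i. \<tau> (k + i))" if "i < 2 * k + 1" for i
    proof (cases "i \<le> k")
      case True then show ?thesis unfolding star_edges_def by (auto simp: add.commute)
    next
      case False
      then obtain j where "i = k + Suc j" by (metis less_iff_Suc_add linorder_not_le add_Suc_right)
      then show ?thesis using that wrap[of j] unfolding star_edges_def by auto
    qed
    moreover have "edge n (\<tau> i) (\<tau> (k + Suc i)) \<in> S" if "i < k" for i
      unfolding S\<tau> using that wrap[of i] by (intro CollectI exI[of _ "k + Suc i"]) auto
    ultimately show ?thesis using in1 unfolding S\<tau> star_edges_def by auto
  qed
  ultimately show ?thesis by blast
qed

section \<open>Existence and uniqueness of the star\<close>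

theorem theorem4p1:
  fixes k n :: nat and p :: "nat \<Rightarrow> complex" and T :: "nat set set" and u v w :: nat
  assumes "k \<ge> 1" and "n \<ge> 2 * k + 1"
    and "inscribed_polygon n p"
    and "k_triangulation n p k T"
    and "k_relevant_angle n k T u v w"
  shows "\<exists>!S. k_star n k S \<and> S \<subseteq> T \<and> is_angle n S u v w"
proof -
  note poly = assms(3)
  let ?R = "\<lambda>x y. edge n x y \<in> T"
  have ang: "is_angle n T u v w" and len: "edge_length n u v \<ge> k" "edge_length n v w \<ge> k"
    using assms(5) by (auto simp: k_relevant_angle_def k_relevant_edge_def k_boundary_edge_def)
  then have lt: "u < n" "v < n" "w < n" and ccw: "ccw u v w" and T: "{u, v} \<in> T" "{v, w} \<in> T"
    and no: "\<And>t. t < n \<Longrightarrow> ccw w t u \<Longrightarrow> {v, t} \<notin> T"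
    by (auto simp: is_angle_def)
  define U where "U = int u"
  have U: "vtx n U = u" using lt by (simp add: U_def vtx_of_nat)
  obtain V where V: "U \<le> V" "V < U + int n" "vtx n V = v" using vtx_lift lt by blast
  obtain W where W: "U \<le> W" "W < U + int n" "vtx n W = w" using vtx_lift lt by blast
  have UV: "U < V" "U < W" using V W U ccw ccw_distinct by (metis order_le_less)+
  then have VW: "V < W" using ccw ccw_vtx_iff[of U V n W] U V W by simp
  have R: "?R U V" "?R V W" using T U V W by (simp_all add: edge_def)
  \<comment> \<open>An edge length is a minimum over both arcs, so it bounds the arcs from
    \<open>U\<close> to \<open>V\<close> and from \<open>V\<close> to \<open>W\<close>.\<close>
  have far: "U + int k \<le> V" "V + int k \<le> W"
    using len card_cyclic_interval[of U V n] card_cyclic_interval[of V W n] U V W UV VW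
    unfolding edge_length_def by auto
  have angle: "\<not> ?R V t" if "W < t" "t < U + int n" for t
    using no[of "vtx n t"] ccw_vtx[of W t "U + int n" n] that U V W UV VW vtx_less[of n t] lt
    by (auto simp: edge_def)
  have sym: "?R x y = ?R y x" and per: "?R (x + int n) y = ?R x y" for x y
    by (simp_all add: edge_def insert_commute)
  have free: "\<nexists>c d. lcross (int n) ?R (Suc k) c d"
    using lcross_imp_is_crossing[OF poly, of T "Suc k"] assms(4)
    unfolding k_triangulation_def crossing_free_def Suc_eq_plus1 by blast
  note sat = k_triangulation_saturated[OF poly assms(4)]
  obtain a b where fan: "fan ?R k U V W a b"
    and max: "\<And>a' b'. fan ?R k U V W a' b' \<Longrightarrow> spread k a' b' \<le> spread k a b"
  proof -
    have "\<exists>a b. fan ?R k U V W a b"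
      by (rule boundary_fan[OF sat]) (use assms(1,2) far R in auto)
    then show ?thesis using that maximal_fan_exists by metis
  qed
  have star: "?R (a i) (b (Suc i))" if "i < k" for i
    by (rule maximal_fan_is_star[OF sym per free sat angle fan W(2) that max])
  show ?thesis
  proof (rule ex1I)
    let ?S = "star_edges n k a b"
    have sub: "?S \<subseteq> T" using fanD(9)[OF fan] star by (auto simp: star_edges_def)
    have "edge n (a 0) (b 0) \<in> ?S" "edge n (a k) (b k) \<in> ?S" unfolding star_edges_def by blast+
    then have "{u, v} \<in> ?S" "{v, w} \<in> ?S"
      using U V(3) W(3) fanD(5-8)[OF fan] by (simp_all add: edge_def)
    \<comment> \<open>No edge of \<open>T\<close> lies inside the angle, hence none of the
      star.\<close>
    then have "is_angle n ?S u v w" using lt ccw sub no by (auto simp: is_angle_def)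
    then show "k_star n k ?S \<and> ?S \<subseteq> T \<and> is_angle n ?S u v w"
      using sub k_star_star_edges[OF fan W(2)] by simp
  next
    fix S assume S: "k_star n k S \<and> S \<subseteq> T \<and> is_angle n S u v w"
    then have "edge n U V \<in> S" "edge n V W \<in> S"
      using U V(3) W(3) by (auto simp: is_angle_def edge_def)
    then obtain a' b' where f: "fan (\<lambda>x y. edge n x y \<in> S) k U V W a' b'" and S': "S = star_edges n k a' b'"
      using k_star_angle_fan[of n k S U V W] S assms(1) UV VW W by blast
    have fan': "fan ?R k U V W a' b'" using f S unfolding fan_def by auto
    have star': "?R (a' i) (b' (Suc i))" if "i < k" for i
      using S that unfolding S' star_edges_def by blast
    \<comment> \<open>Each star dominates the fan of the other.\<close>
    have "a i = a' i \<and> b i = b' i" if "i \<le> k" for i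
      using star_dominates_fan[OF free fan W(2) star fan' that]
        star_dominates_fan[OF free fan' W(2) star' fan that] by auto
    then show "S = star_edges n k a b" unfolding S' star_edges_def
      by (intro arg_cong2[where f = "(\<union>)"] Collect_cong) (metis Suc_leI less_imp_le)+
  qed
qed

end
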